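(* Let $\sigma(z)=z+\frac{\sigma''}{2}z^2$ and $\kappa(z)=m+\kappa'z$ with constants $\sigma'',\kappa',m\in\mathbb{C}$, and let $\omega\in\mathbb{C}$. Set $$\kappa^\circ(z):=-m+(\kappa'-m\sigma'')z,\qquad \omega^\circ:=\omega-m\kappa'+m^2\frac{\sigma''}{2}.$$ Then, as differential operators, $$z^m\big(\mathcal{H}(\sigma,\kappa)+\omega\big)z^{-m}=\mathcal{H}(\sigma,\kappa^\circ)+\omega^\circ .$$
   Context: For polynomials $\sigma,\kappa$ with $\deg\sigma\le2$, $\deg\kappa\le1$, $$\mathcal{H}(\sigma,\kappa):=\sigma(z)\partial_z^2+\big(\sigma'(z)+\kappa(z)\big)\partial_z+\tfrac12\kappa'.$$ $z^{\pm m}$ are multiplication operators by a fixed branch of the power function and its inverse, on a simply connected region of $\mathbb{C}\setminus\{0\}$. *)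

theory Defs
  imports "HOL-Complex_Analysis.Complex_Analysis"
begin

type_synonym operator = "(complex \<Rightarrow> complex) \<Rightarrow> complex \<Rightarrow> complex"

text \<open>The theory uses this only for \<open>degree \<sigma> \<le> 2\<close> and \<open>degree \<kappa> \<le> 1\<close>; in that case
  the zeroth-order coefficient \<open>\<kappa>'/2\<close> is a constant.\<close>

definition hyp_op :: "complex poly \<Rightarrow> complex poly \<Rightarrow> operator" where
  "hyp_op \<sigma> \<kappa> f z =
     poly \<sigma> z * (deriv ^^ 2) f z
     + (poly (pderiv \<sigma>) z + poly \<kappa> z) * deriv f z
     + 1/2 * poly (pderiv \<kappa>) z * f z"

definition mult_op :: "(complex \<Rightarrow> complex) \<Rightarrow> operator" where
  "mult_op g f z = g z * f z"

definition add_scalar_op :: "operator \<Rightarrow> complex \<Rightarrow> operator" where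
  "add_scalar_op A c f z = A f z + c * f z"

text \<open>\<open>P\<close> is a branch of \<open>z\<^sup>m\<close> on \<open>U\<close>, for a complex exponent \<open>m\<close>: it is \<open>exp (m * L z)\<close> for a
  holomorphic branch \<open>L\<close> of the logarithm on \<open>U\<close>.\<close>

definition power_branch_on :: "complex set \<Rightarrow> complex \<Rightarrow> (complex \<Rightarrow> complex) \<Rightarrow> bool" where
  "power_branch_on U m P \<longleftrightarrow>
     (\<exists>L. L holomorphic_on U \<and> (\<forall>z\<in>U. exp (L z) = z) \<and> (\<forall>z\<in>U. P z = exp (m * L z)))"

text \<open>Equality as differential operators on an open set \<open>U\<close>: operators are local, so they are
  compared on all holomorphic functions on all open subsets of \<open>U\<close>. Values outside the domain
  of the function carry no information and are ignored.\<close>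

definition diff_op_eq_on :: "complex set \<Rightarrow> operator \<Rightarrow> operator \<Rightarrow> bool" where
  "diff_op_eq_on U A B \<longleftrightarrow>
     (\<forall>V f. open V \<longrightarrow> V \<subseteq> U \<longrightarrow> f holomorphic_on V \<longrightarrow> (\<forall>z\<in>V. A f z = B f z))"

end

theory Submission
  imports Defs
begin

text \<open>Since \<open>(z\<^sup>-\<^sup>m h)' = z\<^sup>-\<^sup>m (h' - m h / z)\<close>, conjugation by \<open>z\<^sup>m\<close> replaces \<open>\<partial>\<close> by
  \<open>\<partial> - m / z\<close>. The resulting poles at \<open>0\<close> cancel because \<open>\<sigma>(0) = 0\<close>, \<open>\<sigma>'(0) = 1\<close> and
  \<open>\<kappa>(0) = m\<close>, and comparing coefficients gives the claim.\<close>

text \<open>Differentiating \<open>exp (L w) = w\<close> gives \<open>z * deriv L z = 1\<close>,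
  which also forces \<open>z\<close> to be nonzero.\<close>

lemma has_field_derivative_log_branch:
  fixes L :: "complex \<Rightarrow> complex"
  assumes "open U" "L holomorphic_on U" "\<And>w. w \<in> U \<Longrightarrow> exp (L w) = w" "z \<in> U"
  shows "(L has_field_derivative 1 / z) (at z)"
proof -
  have dL: "(L has_field_derivative deriv L z) (at z)"
    using assms by (intro holomorphic_derivI) auto
  have "((\<lambda>w. exp (L w)) has_field_derivative exp (L z) * deriv L z) (at z)"
    using dL by (auto intro!: derivative_eq_intros)
  then have "((\<lambda>w. w) has_field_derivative z * deriv L z) (at z)"
    using assms by (auto elim!: has_field_derivative_transform_within_open[of _ _ _ U])
  then have "z * deriv L z = 1"
    using DERIV_ident DERIV_unique by blast
  then have "deriv L z = 1 / z"
    by (metis div_by_1 divide_eq_eq mult.commute mult_zero_left zero_neq_one)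
  then show ?thesis
    using dL by simp
qed

lemma power_branch_on_nonzero:
  assumes "power_branch_on U m P" "z \<in> U"
  shows "P z \<noteq> 0"
  using assms by (auto simp: power_branch_on_def)

text \<open>On \<open>U\<close> the inverse of \<open>P\<close> is \<open>exp (- m * L w)\<close>,
  so the product rule with \<open>L' = 1 / z\<close> applies. Only differentiability of
  \<open>h\<close> at the point is assumed, so the rule can be iterated.\<close>

lemma has_field_derivative_inverse_power_branch_mult:
  assumes "open U" "power_branch_on U m P" "z \<in> U"
    and h: "(h has_field_derivative h') (at z)"
  shows "((\<lambda>w. inverse (P w) * h w) has_field_derivative
           inverse (P z) * (h' - m * h z / z)) (at z)"
proof -
  obtain L where L: "L holomorphic_on U" "\<And>w. w \<in> U \<Longrightarrow> exp (L w) = w"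
    and P: "\<And>w. w \<in> U \<Longrightarrow> P w = exp (m * L w)"
    using assms(2) by (auto simp: power_branch_on_def)
  have dL: "(L has_field_derivative 1 / z) (at z)"
    using has_field_derivative_log_branch[OF assms(1) L assms(3)] .
  have "((\<lambda>w. exp (- m * L w) * h w) has_field_derivative
          exp (- m * L z) * (h' - m * h z / z)) (at z)"
    by (rule derivative_eq_intros dL h refl | simp add: algebra_simps)+
  moreover have "inverse (P w) = exp (- m * L w)" if "w \<in> U" for w
    using P[OF that] by (simp add: exp_minus)
  ultimately show ?thesis
    using assms(1,3) by (auto elim!: has_field_derivative_transform_within_open[of _ _ _ U])
qed

theorem theorem4p2:
  fixes \<sigma>2 \<kappa>1 m \<omega> \<omega>c :: complex
    and \<sigma> \<kappa> \<kappa>c :: "complex poly"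
    and U :: "complex set"
    and P :: "complex \<Rightarrow> complex"
  assumes "open U" and "simply_connected U" and "0 \<notin> U"
    and "power_branch_on U m P"
    and "\<sigma> = [:0, 1, \<sigma>2 / 2:]"
    and "\<kappa> = [:m, \<kappa>1:]"
    and "\<kappa>c = [:- m, \<kappa>1 - m * \<sigma>2:]"
    and "\<omega>c = \<omega> - m * \<kappa>1 + m^2 * (\<sigma>2 / 2)"
  shows "diff_op_eq_on U
           (mult_op P \<circ> add_scalar_op (hyp_op \<sigma> \<kappa>) \<omega> \<circ> mult_op (\<lambda>z. inverse (P z)))
           (add_scalar_op (hyp_op \<sigma> \<kappa>c) \<omega>c)"
  unfolding diff_op_eq_on_def
proof (intro allI impI ballI)
  fix V f z
  assume V: "open V" "V \<subseteq> U" and f: "f holomorphic_on V" and z: "z \<in> V"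
  define g where "g = (\<lambda>w. inverse (P w) * f w)"
  \<comment> \<open>This is \<open>f\<close> under the conjugated derivation
    \<open>\<partial> - m / w\<close>; \<open>deriv g\<close> then has the same shape as
    \<open>g\<close>, with \<open>h\<close> in place of \<open>f\<close>.\<close>
  define h where "h = (\<lambda>w. deriv f w - m * f w / w)"
  have nz: "w \<noteq> 0" if "w \<in> V" for w
    using that V assms(3) by auto
  have df: "(f has_field_derivative deriv f w) (at w)" if "w \<in> V" for w
    using that V f by (intro holomorphic_derivI) auto
  have ddf: "(deriv f has_field_derivative deriv (deriv f) z) (at z)"
    using z V f holomorphic_deriv holomorphic_derivI by blast
  \<comment> \<open>Needed on all of the open set \<open>V\<close>, not just at \<open>z\<close>,
    because \<open>deriv g\<close> is differentiated once more.\<close>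
  have dg: "deriv g w = inverse (P w) * h w" if "w \<in> V" for w
    unfolding g_def h_def
    using has_field_derivative_inverse_power_branch_mult[OF assms(1,4) _ df] that V
    by (intro DERIV_imp_deriv) auto
  have dh: "(h has_field_derivative
      deriv (deriv f) z - m * (deriv f z / z - f z / z^2)) (at z)"
    unfolding h_def using nz[OF z]
    by (auto intro!: derivative_eq_intros ddf df[OF z] simp: field_simps power2_eq_square)
  have "((\<lambda>w. inverse (P w) * h w) has_field_derivative
      inverse (P z) * (deriv (deriv f) z - m * (deriv f z / z - f z / z^2) - m * h z / z)) (at z)"
    using has_field_derivative_inverse_power_branch_mult[OF assms(1,4) _ dh] z V by auto
  then have "(deriv g has_field_derivative
      inverse (P z) * (deriv (deriv f) z - m * (deriv f z / z - f z / z^2) - m * h z / z)) (at z)"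
    using z V dg by (auto elim!: has_field_derivative_transform_within_open[of _ _ _ V])
  then have ddg: "deriv (deriv g) z =
      inverse (P z) * (deriv (deriv f) z - m * (deriv f z / z - f z / z^2) - m * h z / z)"
    by (rule DERIV_imp_deriv)
  have gz: "g z = inverse (P z) * f z"
    by (simp add: g_def)
  have "P z \<noteq> 0"
    using power_branch_on_nonzero[OF assms(4)] z V by auto
  have mult_eq: "mult_op (\<lambda>z. inverse (P z)) f = g"
    by (auto simp: mult_op_def g_def)
  \<comment> \<open>The value at \<open>z\<close> of \<open>(\<partial> - m / z)\<close> applied
    twice to \<open>f\<close>, that is,
    \<open>f'' - 2 * m * f' / z + (m + m^2) * f / z^2\<close>.\<close>
  define D where "D = deriv (deriv f) z - m * (deriv f z / z - f z / z^2) - m * h z / z"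
  have "(mult_op P \<circ> add_scalar_op (hyp_op \<sigma> \<kappa>) \<omega> \<circ> mult_op (\<lambda>z. inverse (P z))) f z =
      P z * inverse (P z) * (poly \<sigma> z * D + (poly (pderiv \<sigma>) z + poly \<kappa> z) * h z
        + 1/2 * poly (pderiv \<kappa>) z * f z + \<omega> * f z)"
    unfolding o_apply mult_eq mult_op_def[of P] add_scalar_op_def hyp_op_def
    by (simp add: numeral_2_eq_2 ddg[folded D_def] dg[OF z] gz algebra_simps)
  also have "\<dots> = poly \<sigma> z * D + (poly (pderiv \<sigma>) z + poly \<kappa> z) * h z
        + 1/2 * poly (pderiv \<kappa>) z * f z + \<omega> * f z"
    using \<open>P z \<noteq> 0\<close> by simp
  \<comment> \<open>The coefficient of \<open>f'\<close> is \<open>\<sigma>' + \<kappa> - 2 * m *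
    \<sigma> / z = \<sigma>' + \<kappa>c\<close>. In that of \<open>f\<close> the poles
    \<open>(m + m^2) / z\<close> and \<open>- m * (1 + m) / z\<close> cancel, and the rest is
    \<open>(\<kappa>1 - m * \<sigma>2) / 2 + \<omega>c\<close>.\<close>
  also have "\<dots> = add_scalar_op (hyp_op \<sigma> \<kappa>c) \<omega>c f z"
    unfolding add_scalar_op_def hyp_op_def assms(5-8) D_def h_def
    using nz[OF z]
    by (simp add: numeral_2_eq_2 pderiv_pCons divide_simps) (simp add: algebra_simps)
  finally show "(mult_op P \<circ> add_scalar_op (hyp_op \<sigma> \<kappa>) \<omega> \<circ> mult_op (\<lambda>z. inverse (P z))) f z =
      add_scalar_op (hyp_op \<sigma> \<kappa>c) \<omega>c f z" .
qed

end
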